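(* Let $H$ be a complex Hilbert space and $T$ a bounded linear operator on $H$. Then $$|\cos|\,T=\inf_{f\in H,\;Tf\neq0}\ \sup_{\theta\in\mathbb{R}}\ \mu_\theta(f).$$
   Context: The total cosine (total antieigenvalue) of a bounded linear operator $T$ on $H$ is $$|\cos|\,T=\inf_{f\in H,\;Tf\neq0}\frac{|\langle Tf,f\rangle|}{\|Tf\|\,\|f\|}.$$ For $\theta\in\mathbb{R}$ and $f\in H$ with $Tf\neq0$, $$\mu_\theta(f)=\frac{\cos\theta\,\operatorname{Re}\langle Tf,f\rangle+\sin\theta\,\operatorname{Im}\langle Tf,f\rangle}{\|Tf\|\,\|f\|}.$$ *)

theory Defs
  imports "HOL-Analysis.Analysis"
begin

text \<open>
  Complex inner product spaces, layered on top of \<open>real_normed_vector\<close> so that the norm, topology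
  and completeness are the library's. The inner product is linear in the first argument.
\<close>

class complex_inner = real_normed_vector +
  fixes scaleC :: "complex \<Rightarrow> 'a \<Rightarrow> 'a" (infixr "*\<^sub>C" 75)
    and cinner :: "'a \<Rightarrow> 'a \<Rightarrow> complex"
  assumes scaleR_scaleC: "r *\<^sub>R x = complex_of_real r *\<^sub>C x"
    and scaleC_add_right: "a *\<^sub>C (x + y) = a *\<^sub>C x + a *\<^sub>C y"
    and scaleC_add_left: "(a + b) *\<^sub>C x = a *\<^sub>C x + b *\<^sub>C x"
    and scaleC_scaleC: "a *\<^sub>C b *\<^sub>C x = (a * b) *\<^sub>C x"
    and scaleC_one: "1 *\<^sub>C x = x"
    and cinner_commute: "cinner x y = cnj (cinner y x)"
    and cinner_add_left: "cinner (x + y) z = cinner x z + cinner y z"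
    and cinner_scaleC_left: "cinner (a *\<^sub>C x) y = a * cinner x y"
    and cinner_ge_zero: "0 \<le> Re (cinner x x)"
    and cinner_eq_zero_iff: "cinner x x = 0 \<longleftrightarrow> x = 0"
    and norm_eq_sqrt_cinner: "norm x = sqrt (Re (cinner x x))"

class complex_hilbert_space = complex_inner + banach

instantiation complex :: complex_hilbert_space
begin

definition scaleC_complex :: "complex \<Rightarrow> complex \<Rightarrow> complex"
  where "scaleC_complex a x = a * x"

definition cinner_complex :: "complex \<Rightarrow> complex \<Rightarrow> complex"
  where "cinner_complex x y = x * cnj y"

instance
  by standard
    (auto simp: scaleC_complex_def cinner_complex_def algebra_simps scaleR_conv_of_real
      cmod_def power2_eq_square)

end

text \<open>\<open>bounded_linear\<close> only gives real linearity, so complex homogeneity is added.\<close>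

definition bounded_clinear :: "('a::complex_inner \<Rightarrow> 'b::complex_inner) \<Rightarrow> bool"
  where "bounded_clinear T \<longleftrightarrow> bounded_linear T \<and> (\<forall>c f. T (c *\<^sub>C f) = c *\<^sub>C T f)"

text \<open>
  The infimum is taken in \<open>ereal\<close>, where it exists for every \<open>T\<close>; for \<open>T = 0\<close> the index set is
  empty and the value is \<open>\<infinity>\<close>.
\<close>

definition total_cosine :: "('a::complex_inner \<Rightarrow> 'a) \<Rightarrow> ereal"
  where "total_cosine T =
    (INF f\<in>{f. T f \<noteq> 0}. ereal (cmod (cinner (T f) f) / (norm (T f) * norm f)))"

definition mu :: "('a::complex_inner \<Rightarrow> 'a) \<Rightarrow> real \<Rightarrow> 'a \<Rightarrow> real"
  where "mu T \<theta> f =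
    (cos \<theta> * Re (cinner (T f) f) + sin \<theta> * Im (cinner (T f) f)) / (norm (T f) * norm f)"

end

theory Submission
  imports Defs
begin

text \<open>
  The identity holds for each vector separately: \<open>cos \<theta> * Re z + sin \<theta> * Im z\<close> is the real part
  of \<open>z\<close> rotated by \<open>-\<theta>\<close>, which is at most \<open>\<bar>z\<bar>\<close>, with equality for \<open>\<theta> = Arg z\<close>.
\<close>

lemma cos_Re_sin_Im_eq_Re_cis: "cos \<theta> * Re z + sin \<theta> * Im z = Re (z * cis (- \<theta>))"
  by simp

lemma cos_Re_sin_Im_le_cmod: "cos \<theta> * Re z + sin \<theta> * Im z \<le> cmod z"
  using complex_Re_le_cmod[of "z * cis (- \<theta>)"]
  by (simp only: cos_Re_sin_Im_eq_Re_cis norm_mult norm_cis mult_1_right)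

text \<open>In the polar form of \<open>z\<close> the rotation cancels the phase. This includes
  \<open>z = 0\<close>, where both sides vanish.\<close>

lemma cos_Re_sin_Im_Arg: "cos (Arg z) * Re z + sin (Arg z) * Im z = cmod z"
proof -
  have "z * cis (- Arg z) = rcis (cmod z) (Arg z) * cis (- Arg z)"
    by (simp add: rcis_cmod_Arg)
  also have "\<dots> = complex_of_real (cmod z)"
    by (simp add: rcis_def cis_mult)
  finally show ?thesis
    by (simp only: cos_Re_sin_Im_eq_Re_cis Re_complex_of_real)
qed

text \<open>The supremum is attained at the argument of \<open>cinner (T f) f\<close>. If
  \<open>T f = 0\<close>, both sides are 0, since division by zero gives 0.\<close>

lemma SUP_mu:
  "(SUP \<theta>::real. ereal (mu T \<theta> f)) = ereal (cmod (cinner (T f) f) / (norm (T f) * norm f))"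
proof (rule antisym)
  show "(SUP \<theta>::real. ereal (mu T \<theta> f)) \<le> ereal (cmod (cinner (T f) f) / (norm (T f) * norm f))"
    by (intro SUP_least) (simp add: mu_def divide_right_mono cos_Re_sin_Im_le_cmod)
  show "ereal (cmod (cinner (T f) f) / (norm (T f) * norm f)) \<le> (SUP \<theta>::real. ereal (mu T \<theta> f))"
    by (rule SUP_upper2[of "Arg (cinner (T f) f)"]) (simp_all add: mu_def cos_Re_sin_Im_Arg)
qed

theorem theorem4:
  fixes T :: "'a::complex_hilbert_space \<Rightarrow> 'a"
  assumes "bounded_clinear T"
  shows "total_cosine T = (INF f\<in>{f. T f \<noteq> 0}. SUP \<theta>::real. ereal (mu T \<theta> f))"
  \<comment> \<open>Both infima range over the same set, so the vectorwise identity suffices; for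
    \<open>T = 0\<close> both are \<infinity>.\<close>
  by (simp add: total_cosine_def SUP_mu)

end
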